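(* Let $n,d,k$ be integers with $2\leq k\leq d-1\leq n-2$, let $K_n^k$ be the complete $k$-uniform hypergraph on $n$ vertices (all $k$-subsets of the vertex set are hyperedges), and let $p$ be a generic realisation of $K_n^k$ in $\mathbb R^d$. Then $(K_n^k,p)$ is volume rigid.
   Context: A hypergraph $H=(V,E)$ has a finite vertex set $V$ and a set $E$ of subsets of $V$ (hyperedges), each of size at least 2; it is $k$-uniform if every hyperedge has size $k$. A realisation of $H$ in $\mathbb R^d$ is a map $p:V\to\mathbb R^d$; it is generic if its $d|V|$ coordinates are algebraically independent over $\mathbb Q$. Equip $\bigwedge^k\mathbb R^d$ with the inner product $\langle x_1\wedge\dots\wedge x_k,y_1\wedge\dots\wedge y_k\rangle=\det[\langle x_i,y_j\rangle]_{i,j}$ and its norm $\|\cdot\|$. For $P=\{p_1,\dots,p_{k+1}\}\subset\mathbb R^d$ put $\mathrm{Vol}(P)=\frac{1}{k!}\|(p_2-p_1)\wedge\dots\wedge(p_{k+1}-p_1)\|$. Realisations $p,q$ are volume equivalent if $\mathrm{Vol}(p(\Delta))=\mathrm{Vol}(q(\Delta))$ for all $\Delta\in E$, and congruent if $q(v)=Ap(v)+t$ for all $v$, for some orthogonal $A$ and $t\in\mathbb R^d$. $(H,p)$ is volume rigid if there is a neighbourhood $N$ of $p$ in $\mathbb R^{d|V|}$ such that every $q\in N$ volume equivalent to $p$ is congruent to $p$. *)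

theory Defs
  imports "HOL-Analysis.Analysis" "HOL-Combinatorics.Permutations"
begin

text \<open>Gram determinant of a list of vectors, written out via the Leibniz formula:
  det [<x_i, x_j>]_{i,j}.  This equals the squared norm of x_1 wedge ... wedge x_m
  in the exterior power with the induced inner product.\<close>
definition gram_det :: "'a::real_inner list \<Rightarrow> real" where
  "gram_det xs = (\<Sum>\<sigma> | \<sigma> permutes {..<length xs}.
      of_int (sign \<sigma>) * (\<Prod>i<length xs. inner (xs ! i) (xs ! (\<sigma> i))))"

definition wedge_norm :: "'a::real_inner list \<Rightarrow> real" where
  "wedge_norm xs = sqrt (gram_det xs)"

definition simplex_vol :: "'a::real_inner list \<Rightarrow> real" where
  "simplex_vol ps = wedge_norm (map (\<lambda>x. x - hd ps) (tl ps)) / fact (length ps - 1)"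

definition edge_vol :: "(nat \<Rightarrow> 'a::real_inner) \<Rightarrow> nat set \<Rightarrow> real" where
  "edge_vol p \<Delta> = simplex_vol (map p (sorted_list_of_set \<Delta>))"

definition complete_hyper :: "nat \<Rightarrow> nat \<Rightarrow> nat set set" where
  "complete_hyper n k = {\<Delta>. \<Delta> \<subseteq> {0..<n} \<and> card \<Delta> = k}"

text \<open>Algebraic independence over Q of a finite family (x_i)_{i in I} of reals:
  no nonzero polynomial with rational coefficients in the variables indexed by I
  vanishes at x.  A polynomial is a finite set M of exponent vectors supported in I
  with rational coefficients c.\<close>
definition alg_indep_Q :: "'i set \<Rightarrow> ('i \<Rightarrow> real) \<Rightarrow> bool" where
  "alg_indep_Q I x \<longleftrightarrow>
     (\<forall>M c. finite M \<and> (\<forall>\<alpha>\<in>M. \<forall>i. i \<notin> I \<longrightarrow> \<alpha> i = 0) \<and> (\<forall>\<alpha>\<in>M. c \<alpha> \<in> \<rat>) \<and>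
        (\<Sum>\<alpha>\<in>M. c \<alpha> * (\<Prod>i\<in>I. x i ^ \<alpha> i)) = 0
        \<longrightarrow> (\<forall>\<alpha>\<in>M. c \<alpha> = 0))"

definition generic :: "nat \<Rightarrow> (nat \<Rightarrow> 'a::euclidean_space) \<Rightarrow> bool" where
  "generic n p \<longleftrightarrow> alg_indep_Q ({0..<n} \<times> Basis) (\<lambda>(v, b). p v \<bullet> b)"

definition volume_equivalent :: "nat set set \<Rightarrow> (nat \<Rightarrow> 'a::real_inner) \<Rightarrow> (nat \<Rightarrow> 'a) \<Rightarrow> bool" where
  "volume_equivalent E p q \<longleftrightarrow> (\<forall>\<Delta>\<in>E. edge_vol p \<Delta> = edge_vol q \<Delta>)"

definition congruent :: "nat set \<Rightarrow> (nat \<Rightarrow> 'a::euclidean_space) \<Rightarrow> (nat \<Rightarrow> 'a) \<Rightarrow> bool" where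
  "congruent V p q \<longleftrightarrow>
     (\<exists>A t. orthogonal_transformation A \<and> (\<forall>v\<in>V. q v = A (p v) + t))"

definition volume_rigid :: "nat set \<Rightarrow> nat set set \<Rightarrow> (nat \<Rightarrow> 'a::euclidean_space) \<Rightarrow> bool" where
  "volume_rigid V E p \<longleftrightarrow>
     (\<exists>\<epsilon>>0. \<forall>q. (\<forall>v\<in>V. dist (q v) (p v) < \<epsilon>) \<and> volume_equivalent E p q
                  \<longrightarrow> congruent V p q)"

end

theory Submission
  imports Defs "Jordan_Normal_Form.Determinant"
begin

text \<open>
  Equal pairwise distances imply congruence, and every pair of vertices lies in a set \<open>S\<close> of \<open>d + 1\<close>
  vertices, so it suffices that near \<open>p\<close> the volumes of the \<open>k\<close>-subsets of \<open>S\<close> determine the squared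
  distances within \<open>S\<close>. The squared volume is a determinant \<open>F\<close> that is polynomial in the squared
  distances, and telescoping over its rows gives \<open>F x - F y = G(x, y) (x - y)\<close> with a polynomial
  matrix \<open>G(x, y)\<close>. If \<open>G(y, y)\<close> has trivial kernel for the squared distances \<open>y\<close> of \<open>p\<close>, then
  \<open>det (G(y, y)\<^sup>T G(x, y)) \<noteq> 0\<close> for all \<open>x\<close> close to \<open>y\<close>, hence \<open>F x = F y\<close> forces \<open>x = y\<close>.
  The determinant \<open>det (G(y, y)\<^sup>T G(y, y))\<close> is a polynomial in the coordinates of \<open>p\<close> with rational
  coefficients, so by genericity it need only be nonzero at one configuration. At the regular simplex
  \<open>G(y, y)\<close> is a nonzero multiple of the inclusion matrix of pairs in \<open>k\<close>-subsets of \<open>S\<close>, which is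
  injective because \<open>2 \<le> k \<le> card S - 2\<close>.
\<close>

hide_const (open) Determinants.det Finite_Cartesian_Product.vec
no_notation scalar_prod (infix "\<bullet>" 70)

section \<open>Polynomial functions with rational coefficients\<close>

text \<open>Closure rules let polynomiality of composite expressions be proved by introduction
  rules; the explicit monomial form that \<open>alg_indep_Q\<close> speaks about is recovered
  afterwards.\<close>

inductive rat_poly_fun :: "'i set \<Rightarrow> (('i \<Rightarrow> real) \<Rightarrow> real) \<Rightarrow> bool" for I where
  const: "c \<in> \<rat> \<Longrightarrow> rat_poly_fun I (\<lambda>x. c)"
| var: "i \<in> I \<Longrightarrow> rat_poly_fun I (\<lambda>x. x i)"
| add: "rat_poly_fun I f \<Longrightarrow> rat_poly_fun I g \<Longrightarrow> rat_poly_fun I (\<lambda>x. f x + g x)"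
| mult: "rat_poly_fun I f \<Longrightarrow> rat_poly_fun I g \<Longrightarrow> rat_poly_fun I (\<lambda>x. f x * g x)"

lemma rat_poly_fun_diff:
  assumes "rat_poly_fun I f" "rat_poly_fun I g"
  shows "rat_poly_fun I (\<lambda>x. f x - g x)"
proof -
  have "rat_poly_fun I (\<lambda>x. f x + (-1) * g x)"
    by (intro rat_poly_fun.intros assms) simp
  then show ?thesis by simp
qed

lemma rat_poly_fun_divide_numeral:
  assumes "rat_poly_fun I f"
  shows "rat_poly_fun I (\<lambda>x. f x / numeral w)"
proof -
  have "rat_poly_fun I (\<lambda>x. f x * (1 / numeral w))"
    by (intro rat_poly_fun.intros assms) simp
  then show ?thesis by simp
qed

lemma rat_poly_fun_sum:
  assumes "\<And>a. a \<in> A \<Longrightarrow> rat_poly_fun I (f a)"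
  shows "rat_poly_fun I (\<lambda>x. \<Sum>a\<in>A. f a x)"
  using assms by (induction A rule: infinite_finite_induct) (auto intro: rat_poly_fun.intros)

lemma rat_poly_fun_prod:
  assumes "\<And>a. a \<in> A \<Longrightarrow> rat_poly_fun I (f a)"
  shows "rat_poly_fun I (\<lambda>x. \<Prod>a\<in>A. f a x)"
  using assms by (induction A rule: infinite_finite_induct) (auto intro: rat_poly_fun.intros)

text \<open>Monomials are numbered by naturals and exponent vectors may repeat, so sums and products
  only combine index sets, without collecting like terms.\<close>

lemma rat_poly_fun_family_form:
  assumes "rat_poly_fun I f" and I: "finite I"
  shows "\<exists>(J :: nat set) m c. finite J \<and> (\<forall>j\<in>J. \<forall>i. i \<notin> I \<longrightarrow> m j i = 0) \<and> (\<forall>j\<in>J. c j \<in> \<rat>) \<and>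
           (\<forall>x. f x = (\<Sum>j\<in>J. c j * (\<Prod>i\<in>I. x i ^ m j i)))"
  using assms(1)
proof induction
  case (const c)
  show ?case
    by (intro exI[of _ "{0}"] exI[of _ "\<lambda>_ _. 0"] exI[of _ "\<lambda>_. c"]) (use const in auto)
next
  case (var i)
  have "(\<Prod>j\<in>I. x j ^ (if j = i then 1 else 0)) = x i" for x :: "'a \<Rightarrow> real"
  proof -
    have "(\<Prod>j\<in>I. x j ^ (if j = i then 1 else 0)) = (\<Prod>j\<in>I. if j = i then x j else 1)"
      by (intro prod.cong) auto
    then show ?thesis using var I by (simp add: prod.delta')
  qed
  then show ?case
    by (intro exI[of _ "{0}"] exI[of _ "\<lambda>_ j. if j = i then 1 else 0"] exI[of _ "\<lambda>_. 1"])
      (use var in auto)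
next
  case (add f g)
  from add.IH(1) obtain J1 m1 c1 where
    1: "finite (J1 :: nat set)" "\<forall>j\<in>J1. \<forall>i. i \<notin> I \<longrightarrow> m1 j i = 0" "\<forall>j\<in>J1. c1 j \<in> \<rat>"
       "\<forall>x. f x = (\<Sum>j\<in>J1. c1 j * (\<Prod>i\<in>I. x i ^ m1 j i))"
    by (elim exE conjE)
  from add.IH(2) obtain J2 m2 c2 where
    2: "finite (J2 :: nat set)" "\<forall>j\<in>J2. \<forall>i. i \<notin> I \<longrightarrow> m2 j i = 0" "\<forall>j\<in>J2. c2 j \<in> \<rat>"
       "\<forall>x. g x = (\<Sum>j\<in>J2. c2 j * (\<Prod>i\<in>I. x i ^ m2 j i))"
    by (elim exE conjE)
  \<comment> \<open>Even and odd numbers keep the monomials of \<open>f\<close> and of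
    \<open>g\<close> apart.\<close>
  let ?u = "\<lambda>j. 2 * j" and ?v = "\<lambda>j. Suc (2 * j)"
  let ?m = "\<lambda>j. if even j then m1 (j div 2) else m2 (j div 2)"
  let ?c = "\<lambda>j. if even j then c1 (j div 2) else c2 (j div 2)"
  have "f x + g x = (\<Sum>j\<in>?u ` J1 \<union> ?v ` J2. ?c j * (\<Prod>i\<in>I. x i ^ ?m j i))" for x
  proof -
    have "?u ` J1 \<inter> ?v ` J2 = {}"
      by (auto simp: image_iff) presburger
    then have "(\<Sum>j\<in>?u ` J1 \<union> ?v ` J2. ?c j * (\<Prod>i\<in>I. x i ^ ?m j i)) =
        (\<Sum>j\<in>?u ` J1. ?c j * (\<Prod>i\<in>I. x i ^ ?m j i)) + (\<Sum>j\<in>?v ` J2. ?c j * (\<Prod>i\<in>I. x i ^ ?m j i))"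
      using 1 2 by (intro sum.union_disjoint) auto
    also have "(\<Sum>j\<in>?u ` J1. ?c j * (\<Prod>i\<in>I. x i ^ ?m j i)) = f x"
      by (subst sum.reindex) (auto simp: inj_on_def 1)
    also have "(\<Sum>j\<in>?v ` J2. ?c j * (\<Prod>i\<in>I. x i ^ ?m j i)) = g x"
      by (subst sum.reindex) (auto simp: inj_on_def 2)
    finally show ?thesis by simp
  qed
  then show ?case
    using 1(1-3) 2(1-3)
    by (intro exI[of _ "?u ` J1 \<union> ?v ` J2"] exI[of _ ?m] exI[of _ ?c] conjI) auto
next
  case (mult f g)
  from mult.IH(1) obtain J1 m1 c1 where
    1: "finite (J1 :: nat set)" "\<forall>j\<in>J1. \<forall>i. i \<notin> I \<longrightarrow> m1 j i = 0" "\<forall>j\<in>J1. c1 j \<in> \<rat>"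
       "\<forall>x. f x = (\<Sum>j\<in>J1. c1 j * (\<Prod>i\<in>I. x i ^ m1 j i))"
    by (elim exE conjE)
  from mult.IH(2) obtain J2 m2 c2 where
    2: "finite (J2 :: nat set)" "\<forall>j\<in>J2. \<forall>i. i \<notin> I \<longrightarrow> m2 j i = 0" "\<forall>j\<in>J2. c2 j \<in> \<rat>"
       "\<forall>x. g x = (\<Sum>j\<in>J2. c2 j * (\<Prod>i\<in>I. x i ^ m2 j i))"
    by (elim exE conjE)
  \<comment> \<open>A product monomial is numbered by the code of its pair of factors.\<close>
  let ?a = "\<lambda>j. fst (prod_decode j)" and ?b = "\<lambda>j. snd (prod_decode j)"
  have "f x * g x = (\<Sum>j\<in>prod_encode ` (J1 \<times> J2). c1 (?a j) * c2 (?b j) * (\<Prod>i\<in>I. x i ^ (m1 (?a j) i + m2 (?b j) i)))"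
    for x
  proof -
    have "f x * g x = (\<Sum>(j1, j2)\<in>J1 \<times> J2. (c1 j1 * (\<Prod>i\<in>I. x i ^ m1 j1 i)) * (c2 j2 * (\<Prod>i\<in>I. x i ^ m2 j2 i)))"
      by (simp add: 1 2 sum_product sum.cartesian_product)
    also have "\<dots> = (\<Sum>(j1, j2)\<in>J1 \<times> J2. c1 j1 * c2 j2 * (\<Prod>i\<in>I. x i ^ (m1 j1 i + m2 j2 i)))"
      by (intro sum.cong) (auto simp: power_add prod.distrib mult_ac)
    finally show ?thesis
      by (subst sum.reindex) (auto simp: inj_prod_encode case_prod_unfold)
  qed
  then show ?case
    using 1(1-3) 2(1-3)
    by (intro exI[of _ "prod_encode ` (J1 \<times> J2)"] exI[of _ "\<lambda>j i. m1 (?a j) i + m2 (?b j) i"]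
          exI[of _ "\<lambda>j. c1 (?a j) * c2 (?b j)"] conjI) auto
qed

text \<open>Collecting repeated exponent vectors gives a form to which algebraic independence
  applies; all collected coefficients vanish, so the function is zero everywhere.\<close>

lemma rat_poly_fun_eq_0_if_alg_indep:
  assumes f: "rat_poly_fun I f" and I: "finite I" and x: "alg_indep_Q I x" and "f x = 0"
  shows "f y = 0"
proof -
  obtain J :: "nat set" and m c where J: "finite J" "\<forall>j\<in>J. \<forall>i. i \<notin> I \<longrightarrow> m j i = 0" "\<forall>j\<in>J. c j \<in> \<rat>"
    and fx: "\<And>x. f x = (\<Sum>j\<in>J. c j * (\<Prod>i\<in>I. x i ^ m j i))"
    using rat_poly_fun_family_form[OF f I] by blast
  define C where "C \<alpha> = (\<Sum>j\<in>{j\<in>J. m j = \<alpha>}. c j)" for \<alpha>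
  have eq: "f x = (\<Sum>\<alpha>\<in>m ` J. C \<alpha> * (\<Prod>i\<in>I. x i ^ \<alpha> i))" for x
    unfolding fx C_def sum_distrib_right
    by (subst sum.image_gen[OF J(1), of _ m]) (auto intro!: sum.cong)
  have "finite (m ` J)" "\<forall>\<alpha>\<in>m ` J. \<forall>i. i \<notin> I \<longrightarrow> \<alpha> i = 0"
    using J by auto
  moreover have "\<forall>\<alpha>\<in>m ` J. C \<alpha> \<in> \<rat>"
    unfolding C_def using J(3) by (intro ballI Rats_sum) simp
  moreover have "(\<Sum>\<alpha>\<in>m ` J. C \<alpha> * (\<Prod>i\<in>I. x i ^ \<alpha> i)) = 0"
    unfolding eq[symmetric] by fact
  ultimately have "\<forall>\<alpha>\<in>m ` J. C \<alpha> = 0"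
    using x unfolding alg_indep_Q_def by blast
  then show ?thesis
    unfolding eq by (auto intro: sum.neutral)
qed

section \<open>Congruence from equal distances\<close>

text \<open>This map is the reflection in the hyperplane orthogonal to \<open>w\<close>; for
  \<open>w = 0\<close>, division by zero turns the formula into the identity.\<close>

lemma orthogonal_reflection:
  fixes w :: "'a::euclidean_space"
  shows "orthogonal_transformation (\<lambda>x. x - (2 * (x \<bullet> w) / (w \<bullet> w)) *\<^sub>R w)"
proof (cases "w = 0")
  case False
  then have w: "w \<bullet> w \<noteq> 0" by simp
  have "linear (\<lambda>x. x - (2 * (x \<bullet> w) / (w \<bullet> w)) *\<^sub>R w)"
    by (rule linearI)
      (simp_all add: inner_add_left add_divide_distrib distrib_left scaleR_add_left scaleR_diff_right)
  moreover have "(x - (2 * (x \<bullet> w) / (w \<bullet> w)) *\<^sub>R w) \<bullet> (y - (2 * (y \<bullet> w) / (w \<bullet> w)) *\<^sub>R w) = x \<bullet> y" for x y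
  proof -
    define a b where "a = 2 * (x \<bullet> w) / (w \<bullet> w)" and "b = 2 * (y \<bullet> w) / (w \<bullet> w)"
    have ab: "a * (w \<bullet> w) = 2 * (x \<bullet> w)" "b * (w \<bullet> w) = 2 * (y \<bullet> w)"
      using w by (simp_all add: a_def b_def)
    have "(x - a *\<^sub>R w) \<bullet> (y - b *\<^sub>R w) = x \<bullet> y - b * (x \<bullet> w) - a * (y \<bullet> w) + a * (b * (w \<bullet> w))"
      by (simp add: inner_diff_left inner_diff_right inner_commute algebra_simps)
    also have "\<dots> = x \<bullet> y + a * (y \<bullet> w) - b * (x \<bullet> w)"
      unfolding ab by (simp add: algebra_simps)
    also have "a * (y \<bullet> w) = b * (x \<bullet> w)"
      by (simp add: a_def b_def)
    finally show ?thesis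
      by (simp add: a_def b_def)
  qed
  ultimately show ?thesis
    unfolding orthogonal_transformation_def by blast
qed (simp add: orthogonal_transformation_id[unfolded id_def])

text \<open>Induction on \<open>V\<close>: if \<open>A\<close> matches the earlier vectors, reflect
  along \<open>w = A (a v) - b v\<close>. Equal norms make the reflection send
  \<open>A (a v)\<close> to \<open>b v\<close>, and equal inner products make \<open>w\<close>
  orthogonal to every earlier \<open>b u\<close>, which therefore stays fixed.\<close>

lemma orthogonal_transformation_if_inner_eq:
  fixes a b :: "'i \<Rightarrow> 'a::euclidean_space"
  assumes "finite V" and "\<And>u v. u \<in> V \<Longrightarrow> v \<in> V \<Longrightarrow> a u \<bullet> a v = b u \<bullet> b v"
  shows "\<exists>A. orthogonal_transformation A \<and> (\<forall>v\<in>V. A (a v) = b v)"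
  using assms
proof (induction V)
  case empty
  show ?case by (rule exI[of _ "\<lambda>x. x"]) (simp add: orthogonal_transformation_id)
next
  case (insert v V)
  obtain A where A: "orthogonal_transformation A" "\<And>u. u \<in> V \<Longrightarrow> A (a u) = b u"
    using insert.IH insert.prems by (meson insertCI)
  define w where "w = A (a v) - b v"
  define R where "R = (\<lambda>x. x - (2 * (x \<bullet> w) / (w \<bullet> w)) *\<^sub>R w)"
  have pres: "A x \<bullet> A y = x \<bullet> y" for x y
    using A(1) by (simp add: orthogonal_transformation_def)
  have "R (b u) = b u" if "u \<in> V" for u
  proof -
    have "b u \<bullet> w = 0"
      using pres[of "a u" "a v"] insert.prems[of u v] A(2)[OF that] that
      by (simp add: w_def inner_diff_right)
    then show ?thesis by (simp add: R_def)
  qed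
  moreover have "R (A (a v)) = b v"
  proof (cases "w = 0")
    case False
    have "2 * (A (a v) \<bullet> w) = w \<bullet> w"
      using pres[of "a v" "a v"] insert.prems[of v v]
      by (simp add: w_def inner_simps inner_commute)
    then show ?thesis using False by (simp add: R_def w_def)
  qed (simp add: R_def w_def)
  ultimately have "\<forall>u\<in>insert v V. (R \<circ> A) (a u) = b u"
    using A(2) by auto
  moreover have "orthogonal_transformation (R \<circ> A)"
    using A(1) orthogonal_reflection[of w] unfolding R_def by (rule orthogonal_transformation_compose[rotated])
  ultimately show ?case by blast
qed

text \<open>Relative to a base vertex, polarization turns distances into inner products; the
  translation then moves the base vertex into place.\<close>

lemma congruent_if_dist_eq:
  fixes p q :: "nat \<Rightarrow> 'a::euclidean_space"
  assumes "finite V" and d: "\<And>u v. u \<in> V \<Longrightarrow> v \<in> V \<Longrightarrow> dist (p u) (p v) = dist (q u) (q v)"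
  shows "congruent V p q"
proof (cases "V = {}")
  case True
  then show ?thesis
    unfolding congruent_def by (intro exI[of _ "\<lambda>x. x"]) (simp add: orthogonal_transformation_id)
next
  case False
  then obtain o' where o: "o' \<in> V" by auto
  have polar: "(x - z) \<bullet> (y - z) = ((dist x z)\<^sup>2 + (dist y z)\<^sup>2 - (dist x y)\<^sup>2) / 2" for x y z :: 'a
    by (simp add: dist_norm power2_norm_eq_inner inner_simps inner_commute)
  obtain A where A: "orthogonal_transformation A" "\<And>v. v \<in> V \<Longrightarrow> A (p v - p o') = q v - q o'"
    using orthogonal_transformation_if_inner_eq[OF \<open>finite V\<close>, of "\<lambda>v. p v - p o'" "\<lambda>v. q v - q o'"]
    by (auto simp: polar d o)
  have "q v = A (p v) + (q o' - A (p o'))" if "v \<in> V" for v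
    using A(2)[OF that] linear_diff[OF orthogonal_transformation_linear[OF A(1)], of "p v" "p o'"]
    by (simp add: algebra_simps)
  then show ?thesis
    unfolding congruent_def using A(1) by blast
qed

section \<open>Determinants\<close>

text \<open>Plain index functions match the shape of \<open>gram_det\<close> and turn row
  replacement into function update.\<close>

definition leibniz_det :: "nat \<Rightarrow> (nat \<Rightarrow> nat \<Rightarrow> real) \<Rightarrow> real" where
  "leibniz_det m a = (\<Sum>\<sigma> | \<sigma> permutes {..<m}. of_int (sign \<sigma>) * (\<Prod>i<m. a i (\<sigma> i)))"

lemma leibniz_det_cong:
  assumes "\<And>i j. i < m \<Longrightarrow> j < m \<Longrightarrow> a i j = b i j"
  shows "leibniz_det m a = leibniz_det m b"
  unfolding leibniz_det_def
proof (intro sum.cong refl arg_cong2[where f = "(*)"] prod.cong)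
  fix \<sigma> i assume "\<sigma> \<in> {\<sigma>. \<sigma> permutes {..<m}}" "i \<in> {..<m}"
  then show "a i (\<sigma> i) = b i (\<sigma> i)"
    using assms permutes_in_image[of \<sigma> "{..<m}" i] by auto
qed

lemma leibniz_det_eq_det: "leibniz_det m a = det (mat m m (\<lambda>(i, j). a i j))"
proof -
  have "det (mat m m (\<lambda>(i, j). a i j)) =
      (\<Sum>\<sigma> | \<sigma> permutes {..<m}. of_int (sign \<sigma>) * (\<Prod>i<m. mat m m (\<lambda>(i, j). a i j) $$ (i, \<sigma> i)))"
    by (subst det_def'[of _ m]) (auto simp: atLeast0LessThan)
  also have "\<dots> = leibniz_det m a"
    unfolding leibniz_det_def
  proof (intro sum.cong refl arg_cong2[where f = "(*)"] prod.cong)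
    fix \<sigma> i assume "\<sigma> \<in> {\<sigma>. \<sigma> permutes {..<m}}" "i \<in> {..<m}"
    then show "mat m m (\<lambda>(i, j). a i j) $$ (i, \<sigma> i) = a i (\<sigma> i)"
      using permutes_in_image[of \<sigma> "{..<m}" i] by auto
  qed
  finally show ?thesis by simp
qed

lemma leibniz_det_row_sum:
  assumes "i < m"
  shows "leibniz_det m (a(i := \<lambda>j. \<Sum>e\<in>E. c e * r e j)) = (\<Sum>e\<in>E. c e * leibniz_det m (a(i := r e)))"
proof -
  have split: "(\<Prod>l<m. (a(i := s)) l (\<sigma> l)) = s (\<sigma> i) * (\<Prod>l\<in>{..<m} - {i}. a l (\<sigma> l))" for s \<sigma>
    using assms by (subst prod.remove[of _ i]) auto
  show ?thesis
    unfolding leibniz_det_def split sum_distrib_left sum_distrib_right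
    by (subst sum.swap) (intro sum.cong refl, simp add: mult_ac)
qed

lemma leibniz_det_identical_rows:
  assumes "i < m" "l < m" "i \<noteq> l" and "a i = a l"
  shows "leibniz_det m a = 0"
  unfolding leibniz_det_eq_det
  by (rule det_identical_rows[where n = m and i = i and j = l]) (use assms in \<open>auto intro!: eq_vecI\<close>)

text \<open>The shape of the i-th telescoping term when \<open>b\<close> is changed into
  \<open>a\<close> one position at a time. The type \<open>'b\<close> is general because positions
  hold scalars for products and rows for determinants.\<close>

definition mixed_rows :: "nat \<Rightarrow> (nat \<Rightarrow> 'b) \<Rightarrow> 'b \<Rightarrow> (nat \<Rightarrow> 'b) \<Rightarrow> nat \<Rightarrow> 'b" where
  "mixed_rows i a r b = (\<lambda>l. if l < i then a l else b l)(i := r)"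

text \<open>In the induction step every old term gains the factor \<open>b m\<close>, and one new
  term replaces \<open>b m\<close> by \<open>a m\<close> behind the factors of
  \<open>a\<close>.\<close>

lemma prod_diff_telescope:
  fixes a b :: "nat \<Rightarrow> 'b::comm_ring_1"
  shows "(\<Prod>i<m. a i) - (\<Prod>i<m. b i) = (\<Sum>i<m. \<Prod>l<m. mixed_rows i a (a i - b i) b l)"
proof (induction m)
  case (Suc m)
  have 1: "(\<Prod>l<Suc m. mixed_rows i a (a i - b i) b l) = (\<Prod>l<m. mixed_rows i a (a i - b i) b l) * b m"
    if "i < m" for i
    using that by (simp add: mixed_rows_def)
  have 2: "(\<Prod>l<Suc m. mixed_rows m a (a m - b m) b l) = (\<Prod>l<m. a l) * (a m - b m)"
    by (simp add: mixed_rows_def)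
  have "(\<Sum>i<Suc m. \<Prod>l<Suc m. mixed_rows i a (a i - b i) b l) =
      (\<Sum>i<m. \<Prod>l<m. mixed_rows i a (a i - b i) b l) * b m + (\<Prod>l<m. a l) * (a m - b m)"
    unfolding sum.lessThan_Suc[of _ m] 2 using 1 by (simp add: sum_distrib_right)
  also have "\<dots> = (\<Prod>i<Suc m. a i) - (\<Prod>i<Suc m. b i)"
    unfolding Suc.IH[symmetric] by (simp add: algebra_simps)
  finally show ?case by simp
qed simp

text \<open>The product telescopes separately for each permutation; exchanging the two sums
  reassembles determinants.\<close>

lemma leibniz_det_diff:
  "leibniz_det m a - leibniz_det m b = (\<Sum>i<m. leibniz_det m (mixed_rows i a (\<lambda>j. a i j - b i j) b))"
proof -
  have eq: "mixed_rows i a (\<lambda>j. a i j - b i j) b l (\<sigma> l) =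
      mixed_rows i (\<lambda>l. a l (\<sigma> l)) (a i (\<sigma> i) - b i (\<sigma> i)) (\<lambda>l. b l (\<sigma> l)) l" for i l \<sigma>
    by (simp add: mixed_rows_def)
  have "leibniz_det m a - leibniz_det m b =
      (\<Sum>\<sigma> | \<sigma> permutes {..<m}. of_int (sign \<sigma>) * ((\<Prod>i<m. a i (\<sigma> i)) - (\<Prod>i<m. b i (\<sigma> i))))"
    by (simp add: leibniz_det_def right_diff_distrib sum_subtractf)
  also have "\<dots> = (\<Sum>i<m. leibniz_det m (mixed_rows i a (\<lambda>j. a i j - b i j) b))"
    unfolding prod_diff_telescope leibniz_det_def eq sum_distrib_left by (rule sum.swap)
  finally show ?thesis .
qed

text \<open>The matrix is the identity plus the all-ones matrix. A kernel vector has every entry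
  equal to \<open>- s\<close>, where \<open>s\<close> is the sum of its entries, so
  \<open>s = - m * s\<close> and the vector is zero.\<close>

lemma leibniz_det_regular_nonzero: "leibniz_det m (\<lambda>i j. if i = j then 2 else 1) \<noteq> 0"
proof
  let ?M = "mat m m (\<lambda>(i, j). if i = j then 2 else 1) :: real mat"
  assume "leibniz_det m (\<lambda>i j. if i = j then 2 else 1) = 0"
  then have "det ?M = 0"
    by (simp add: leibniz_det_eq_det)
  then obtain v where v: "v \<in> carrier_vec m" "v \<noteq> 0\<^sub>v m" "?M *\<^sub>v v = 0\<^sub>v m"
    using det_0_iff_vec_prod_zero[of ?M m] by auto
  define s where "s = (\<Sum>j<m. vec_index v j)"
  have v_eq: "vec_index v i = - s" if "i < m" for i
  proof -
    have "0 = vec_index (?M *\<^sub>v v) i"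
      using v(3) that by simp
    also have "\<dots> = (\<Sum>j<m. (if i = j then 2 else 1) * vec_index v j)"
      using that v(1) by (auto simp: scalar_prod_def atLeast0LessThan intro!: sum.cong)
    also have "\<dots> = (\<Sum>j<m. (if i = j then vec_index v j else 0) + vec_index v j)"
      by (intro sum.cong) auto
    also have "\<dots> = vec_index v i + s"
      using that by (simp add: sum.distrib s_def)
    finally show ?thesis by simp
  qed
  then have "s = - real m * s"
    by (subst s_def) simp
  then have "(1 + real m) * s = 0"
    by (simp add: algebra_simps)
  then have "s = 0" by simp
  then have "v = 0\<^sub>v m"
    using v_eq v(1) by (intro eq_vecI) auto
  with v(2) show False ..
qed

text \<open>The new row is a linear combination of the old ones, and only the coefficient of the replaced
  row survives.\<close>

lemma leibniz_det_regular_replace_row: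
  assumes i: "i < m"
  defines "M \<equiv> \<lambda>i j. if i = j then 2 else 1"
  shows "leibniz_det m (M(i := r)) = (r i - (\<Sum>j<m. r j) / (real m + 1)) * leibniz_det m M"
proof -
  define s where "s = (\<Sum>j<m. r j)"
  \<comment> \<open>These coefficients are \<open>r\<close> times the inverse of \<open>M\<close>,
    which is the identity minus the all-ones matrix divided by \<open>m + 1\<close>.\<close>
  define c where "c l = r l - s / (real m + 1)" for l
  have sc: "(\<Sum>l<m. c l) = s / (real m + 1)"
    by (simp add: c_def sum_subtractf flip: s_def) (simp add: field_simps)
  have r: "(\<Sum>l<m. c l * M l j) = r j" if "j < m" for j
  proof -
    have "(\<Sum>l<m. c l * M l j) = (\<Sum>l<m. (if l = j then c l else 0) + c l)"
      by (intro sum.cong) (auto simp: M_def)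
    also have "\<dots> = r j"
      using that by (simp add: sum.distrib sc) (simp add: c_def)
    finally show ?thesis .
  qed
  have "leibniz_det m (M(i := r)) = leibniz_det m (M(i := \<lambda>j. \<Sum>l<m. c l * M l j))"
    by (rule leibniz_det_cong) (simp add: r)
  also have "\<dots> = (\<Sum>l<m. c l * leibniz_det m (M(i := M l)))"
    by (rule leibniz_det_row_sum[OF i])
  also have "\<dots> = (\<Sum>l<m. if l = i then c i * leibniz_det m M else 0)"
    by (intro sum.cong) (auto intro: leibniz_det_identical_rows[OF i])
  also have "\<dots> = c i * leibniz_det m M"
    using i by simp
  finally show ?thesis by (simp add: c_def s_def)
qed

section \<open>Inclusion of pairs in subsets of fixed size\<close>

text \<open>Exchange argument: comparing \<open>k\<close>-subsets that differ in one vertex shows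
  that \<open>h {a, t} - h {b, t}\<close> sums to zero over each admissible set of
  \<open>k - 1\<close> vertices \<open>t\<close>. A second exchange makes this difference constant
  in \<open>t\<close>, hence zero. So \<open>h\<close> has a single value on all pairs, and any one
  \<open>k\<close>-subset forces it to be zero.\<close>

lemma pair_sums_injective:
  fixes h :: "nat set \<Rightarrow> real"
  assumes S: "finite S" "k + 2 \<le> card S" and k: "2 \<le> k"
    and h0: "\<And>u. h {u} = 0"
    and sums: "\<And>\<Delta>. \<Delta> \<subseteq> S \<Longrightarrow> card \<Delta> = k \<Longrightarrow> (\<Sum>u\<in>\<Delta>. \<Sum>v\<in>\<Delta>. h {u, v}) = 0"
    and uv: "u \<in> S" "v \<in> S" "u \<noteq> v"
  shows "h {u, v} = 0"
proof -
  \<comment> \<open>The double sum runs over ordered pairs, so each new pair counts twice, while the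
    diagonal contributes \<open>h {a} = 0\<close>.\<close>
  have ins: "(\<Sum>u\<in>insert a T. \<Sum>v\<in>insert a T. h {u, v}) = (\<Sum>u\<in>T. \<Sum>v\<in>T. h {u, v}) + 2 * (\<Sum>t\<in>T. h {a, t})"
    if "finite T" "a \<notin> T" for a T
    using that by (simp add: sum.distrib h0 insert_commute)
  have vertex_sum: "(\<Sum>t\<in>T. h {a, t} - h {b, t}) = 0"
    if "a \<in> S" "b \<in> S" "T \<subseteq> S - {a, b}" "card T = k - 1" for a b T
  proof -
    have T: "finite T" using that S by (meson finite_Diff finite_subset)
    have "a \<notin> T" "b \<notin> T" using that by auto
    moreover have "(\<Sum>u\<in>insert x T. \<Sum>v\<in>insert x T. h {u, v}) = 0" if "x \<in> S" "x \<notin> T" for x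
      using that \<open>T \<subseteq> S - {a, b}\<close> \<open>card T = k - 1\<close> T k by (intro sums) auto
    ultimately show ?thesis
      using ins[OF T, of a] ins[OF T, of b] that(1,2) by (simp add: sum_subtractf)
  qed
  have eq: "h {a, c} = h {b, c}" if abc: "a \<in> S" "b \<in> S" "c \<in> S" "c \<noteq> a" "c \<noteq> b" for a b c
  proof (cases "a = b")
    case False
    define g where "g t = h {a, t} - h {b, t}" for t
    \<comment> \<open>Extending the same \<open>k - 2\<close> vertices once by \<open>t\<close> and
      once by \<open>c\<close> gives two vanishing sums that differ only in \<open>g t\<close> and
      \<open>g c\<close>. The bound \<open>k + 2 \<le> card S\<close> leaves room for these vertices
      outside \<open>{a, b, t, c}\<close>.\<close>
    have const: "g t = g c" if t: "t \<in> S - {a, b}" for t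
    proof (cases "t = c")
      case False
      have "card (S - {a, b} - {t, c}) = card S - 4"
        using S t abc False \<open>a \<noteq> b\<close> by (simp add: card_Diff_subset)
      then have "k - 2 \<le> card (S - {a, b} - {t, c})" using S by simp
      then obtain T where T: "T \<subseteq> S - {a, b} - {t, c}" "card T = k - 2"
        by (meson obtain_subset_with_card_n)
      have fT: "finite T" using T S by (meson finite_Diff finite_subset)
      have "(\<Sum>x\<in>insert y T. g x) = 0" if "y \<in> {t, c}" for y
        unfolding g_def
      proof (rule vertex_sum)
        have "y \<notin> T" using that T by auto
        then show "card (insert y T) = k - 1" using fT T(2) k by simp
      qed (use that T t abc in auto)
      then have "sum g (insert t T) = 0" "sum g (insert c T) = 0" by simp_all
      moreover have "t \<notin> T" "c \<notin> T" using T(1) by auto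
      ultimately show ?thesis
        using fT by simp
    qed simp
    have "k - 1 \<le> card (S - {a, b})"
      using S abc False by (simp add: card_Diff_subset)
    then obtain T where T: "T \<subseteq> S - {a, b}" "card T = k - 1"
      by (meson obtain_subset_with_card_n)
    have "0 = (\<Sum>x\<in>T. g x)"
      unfolding g_def using T abc by (intro vertex_sum[symmetric]) auto
    also have "\<dots> = (\<Sum>x\<in>T. g c)"
      using T by (intro sum.cong const) auto
    also have "\<dots> = real (k - 1) * g c" using T by simp
    finally show ?thesis using k by (simp add: g_def)
  qed simp
  \<comment> \<open>Any two pairs are linked by changing one endpoint at a time.\<close>
  have all: "h {a, b} = h {u, v}" if ab: "a \<in> S" "b \<in> S" "a \<noteq> b" for a b
  proof (cases "b = u")
    case True
    then show ?thesis
      using eq[of a v u] ab uv by (simp add: insert_commute)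
  next
    case False
    then show ?thesis
      using eq[of a u b] eq[of b v u] ab uv by (simp add: insert_commute)
  qed
  obtain \<Delta> where \<Delta>: "\<Delta> \<subseteq> S" "card \<Delta> = k"
    using S by (meson add_leD1 obtain_subset_with_card_n)
  have f\<Delta>: "finite \<Delta>" using \<Delta> S finite_subset by blast
  have "0 = (\<Sum>a\<in>\<Delta>. \<Sum>b\<in>\<Delta>. h {a, b})"
    using sums[OF \<Delta>] by simp
  also have "\<dots> = (\<Sum>a\<in>\<Delta>. \<Sum>b\<in>\<Delta> - {a}. h {u, v})"
  proof (rule sum.cong[OF refl])
    fix a assume a: "a \<in> \<Delta>"
    have "(\<Sum>b\<in>\<Delta>. h {a, b}) = (\<Sum>b\<in>\<Delta> - {a}. h {a, b})"
      using f\<Delta> a by (subst sum.remove[of _ a]) (auto simp: h0)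
    also have "\<dots> = (\<Sum>b\<in>\<Delta> - {a}. h {u, v})"
      using a \<Delta> by (intro sum.cong all) auto
    finally show "(\<Sum>b\<in>\<Delta>. h {a, b}) = (\<Sum>b\<in>\<Delta> - {a}. h {u, v})" .
  qed
  also have "\<dots> = real k * real (k - 1) * h {u, v}"
    using \<Delta> f\<Delta> by simp
  finally show ?thesis using k by auto
qed

section \<open>Gram determinants and kernels\<close>

text \<open>This is \<open>det (A\<^sup>T B)\<close> for the matrices \<open>A\<close> and
  \<open>B\<close> with entries \<open>g \<Delta> e\<close> and \<open>g' \<Delta> e\<close>, rows
  in \<open>D\<close> and columns in \<open>es\<close>; the list fixes a numbering of the
  columns.\<close>

definition gramian :: "'e list \<Rightarrow> 'd set \<Rightarrow> ('d \<Rightarrow> 'e \<Rightarrow> real) \<Rightarrow> ('d \<Rightarrow> 'e \<Rightarrow> real) \<Rightarrow> real" where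
  "gramian es D g g' = leibniz_det (length es) (\<lambda>i j. \<Sum>\<Delta>\<in>D. g \<Delta> (es ! i) * g' \<Delta> (es ! j))"

text \<open>A square matrix is singular iff it kills a nonzero vector; distinctness of
  \<open>es\<close> identifies vectors with functions on \<open>set es\<close>.\<close>

lemma gramian_eq_0_iff:
  assumes "distinct es"
  shows "gramian es D g g' = 0 \<longleftrightarrow>
    (\<exists>h. (\<exists>e\<in>set es. h e \<noteq> 0) \<and> (\<forall>e\<in>set es. (\<Sum>\<Delta>\<in>D. g \<Delta> e * (\<Sum>f\<in>set es. g' \<Delta> f * h f)) = 0))"
    (is "_ \<longleftrightarrow> ?R")
proof -
  let ?N = "length es"
  let ?A = "mat ?N ?N (\<lambda>(i, j). \<Sum>\<Delta>\<in>D. g \<Delta> (es ! i) * g' \<Delta> (es ! j))"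
  have sum_es: "(\<Sum>f\<in>set es. F f) = (\<Sum>j<?N. F (es ! j))" for F :: "'a \<Rightarrow> real"
    using sum.reindex_bij_betw[OF bij_betw_nth[OF assms refl refl], of F] by simp
  have Av: "vec_index (?A *\<^sub>v v) i = (\<Sum>\<Delta>\<in>D. g \<Delta> (es ! i) * (\<Sum>f\<in>set es. g' \<Delta> f * h f))"
    if v: "v \<in> carrier_vec ?N" "\<And>j. j < ?N \<Longrightarrow> vec_index v j = h (es ! j)" and i: "i < ?N" for v h i
  proof -
    have "vec_index (?A *\<^sub>v v) i = (\<Sum>j<?N. (\<Sum>\<Delta>\<in>D. g \<Delta> (es ! i) * g' \<Delta> (es ! j)) * h (es ! j))"
      using i v by (auto simp: scalar_prod_def atLeast0LessThan intro!: sum.cong)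
    also have "\<dots> = (\<Sum>\<Delta>\<in>D. g \<Delta> (es ! i) * (\<Sum>f\<in>set es. g' \<Delta> f * h f))"
      unfolding sum_es sum_distrib_left sum_distrib_right by (subst sum.swap) (simp add: mult_ac)
    finally show ?thesis .
  qed
  have "gramian es D g g' = 0 \<longleftrightarrow> (\<exists>v. v \<in> carrier_vec ?N \<and> v \<noteq> 0\<^sub>v ?N \<and> ?A *\<^sub>v v = 0\<^sub>v ?N)"
    unfolding gramian_def leibniz_det_eq_det by (rule det_0_iff_vec_prod_zero) simp
  also have "\<dots> \<longleftrightarrow> ?R"
  proof
    assume "\<exists>v. v \<in> carrier_vec ?N \<and> v \<noteq> 0\<^sub>v ?N \<and> ?A *\<^sub>v v = 0\<^sub>v ?N"
    then obtain v where v: "v \<in> carrier_vec ?N" "v \<noteq> 0\<^sub>v ?N" "?A *\<^sub>v v = 0\<^sub>v ?N" by blast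
    define h where "h e = vec_index v (THE j. j < ?N \<and> es ! j = e)" for e
    have h: "h (es ! j) = vec_index v j" if "j < ?N" for j
    proof -
      have "(THE j'. j' < ?N \<and> es ! j' = es ! j) = j"
        using that assms by (auto simp: nth_eq_iff_index_eq)
      then show ?thesis by (simp add: h_def)
    qed
    have "\<exists>e\<in>set es. h e \<noteq> 0"
    proof (rule ccontr)
      assume "\<not> ?thesis"
      then have "vec_index v j = 0" if "j < ?N" for j
        using h[OF that] that by (metis nth_mem)
      then have "v = 0\<^sub>v ?N" using v(1) by (intro eq_vecI) auto
      with v(2) show False ..
    qed
    moreover have "(\<Sum>\<Delta>\<in>D. g \<Delta> e * (\<Sum>f\<in>set es. g' \<Delta> f * h f)) = 0" if e: "e \<in> set es" for e
    proof -
      obtain i where i: "i < ?N" "e = es ! i" using e by (auto simp: in_set_conv_nth)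
      show ?thesis using Av[of v h i] h v i by simp
    qed
    ultimately show ?R by blast
  next
    assume ?R
    then obtain h where h: "\<exists>e\<in>set es. h e \<noteq> 0"
      "\<And>e. e \<in> set es \<Longrightarrow> (\<Sum>\<Delta>\<in>D. g \<Delta> e * (\<Sum>f\<in>set es. g' \<Delta> f * h f)) = 0" by blast
    define v where "v = vec ?N (\<lambda>j. h (es ! j))"
    have v: "v \<in> carrier_vec ?N" "\<And>j. j < ?N \<Longrightarrow> vec_index v j = h (es ! j)"
      by (simp_all add: v_def)
    obtain j where "j < ?N" "h (es ! j) \<noteq> 0" using h(1) by (auto simp: in_set_conv_nth)
    then have "v \<noteq> 0\<^sub>v ?N" using v(2)[of j] by auto
    moreover have "?A *\<^sub>v v = 0\<^sub>v ?N"
    proof (rule eq_vecI)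
      fix i assume "i < dim_vec (0\<^sub>v ?N)"
      then have i: "i < ?N" by simp
      show "vec_index (?A *\<^sub>v v) i = vec_index (0\<^sub>v ?N) i"
        using trans[OF Av[where h = h, OF v i] h(2)[OF nth_mem[OF i]]] i by simp
    qed simp
    ultimately show "\<exists>v. v \<in> carrier_vec ?N \<and> v \<noteq> 0\<^sub>v ?N \<and> ?A *\<^sub>v v = 0\<^sub>v ?N" using v(1) by blast
  qed
  finally show ?thesis .
qed

text \<open>Pairing \<open>A\<^sup>T A h = 0\<close> with \<open>h\<close> gives a vanishing sum of
  squares, so already \<open>A h = 0\<close>.\<close>

lemma gramian_self_eq_0D:
  assumes "distinct es" "finite D" "gramian es D g g = 0"
  obtains h where "\<exists>e\<in>set es. h e \<noteq> 0" "\<And>\<Delta>. \<Delta> \<in> D \<Longrightarrow> (\<Sum>f\<in>set es. g \<Delta> f * h f) = 0"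
proof -
  obtain h where h: "\<exists>e\<in>set es. h e \<noteq> 0"
      "\<And>e. e \<in> set es \<Longrightarrow> (\<Sum>\<Delta>\<in>D. g \<Delta> e * (\<Sum>f\<in>set es. g \<Delta> f * h f)) = 0"
    using assms gramian_eq_0_iff by blast
  have "0 = (\<Sum>e\<in>set es. h e * (\<Sum>\<Delta>\<in>D. g \<Delta> e * (\<Sum>f\<in>set es. g \<Delta> f * h f)))"
    using h(2) by simp
  also have "\<dots> = (\<Sum>\<Delta>\<in>D. (\<Sum>f\<in>set es. g \<Delta> f * h f)\<^sup>2)"
    unfolding power2_eq_square sum_distrib_left sum_distrib_right
    by (subst sum.swap) (simp add: mult_ac)
  finally have "\<forall>\<Delta>\<in>D. (\<Sum>f\<in>set es. g \<Delta> f * h f)\<^sup>2 = 0"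
    using sum_nonneg_eq_0_iff[OF \<open>finite D\<close>, of "\<lambda>\<Delta>. (\<Sum>f\<in>set es. g \<Delta> f * h f)\<^sup>2"] by simp
  with h(1) show ?thesis by (intro that[of h]) auto
qed

section \<open>Volumes as functions of squared distances\<close>

text \<open>On a pair this is the squared distance. Summing over ordered pairs avoids choosing an
  order of the endpoints, and halving corrects the double count.\<close>

definition sqlen :: "(nat \<Rightarrow> 'a::real_inner) \<Rightarrow> nat set \<Rightarrow> real" where
  "sqlen p e = (\<Sum>u\<in>e. \<Sum>v\<in>e. (p u - p v) \<bullet> (p u - p v)) / 2"

lemma sqlen_pair [simp]: "sqlen p {u, v} = (p u - p v) \<bullet> (p u - p v)"
proof (cases "u = v")
  case False
  have "(p v - p u) \<bullet> (p v - p u) = (p u - p v) \<bullet> (p u - p v)"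
    by (simp add: inner_diff_left inner_diff_right inner_commute)
  then show ?thesis
    using False by (simp add: sqlen_def)
qed (simp add: sqlen_def)

lemma sqlen_singleton [simp]: "sqlen p {u} = 0"
  by (simp add: sqlen_def)

text \<open>The inner product of the edge vectors from vertex \<open>0\<close> to vertices \<open>i + 1\<close> and \<open>j + 1\<close>,
  by polarization.\<close>

definition gram_entry :: "nat list \<Rightarrow> (nat set \<Rightarrow> real) \<Rightarrow> nat \<Rightarrow> nat \<Rightarrow> real" where
  "gram_entry vs x i j =
     (x {vs ! 0, vs ! Suc i} + x {vs ! 0, vs ! Suc j} - x {vs ! Suc i, vs ! Suc j}) / 2"

text \<open>At the squared distances of a configuration this is the squared volume times the square
  of \<open>fact (length vs - 1)\<close>; for arbitrary \<open>x\<close> it is the polynomial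
  \<open>F\<close> of the overview.\<close>

definition vol_poly :: "nat list \<Rightarrow> (nat set \<Rightarrow> real) \<Rightarrow> real" where
  "vol_poly vs x = leibniz_det (length vs - 1) (gram_entry vs x)"

text \<open>\<open>vol_form vs x x\<close> is the derivative of \<open>vol_poly vs\<close> at \<open>x\<close>; for distinct \<open>x\<close>, \<open>y\<close> it is
  a divided difference that is linear in \<open>h\<close>.\<close>

definition vol_form :: "nat list \<Rightarrow> (nat set \<Rightarrow> real) \<Rightarrow> (nat set \<Rightarrow> real) \<Rightarrow> (nat set \<Rightarrow> real) \<Rightarrow> real" where
  "vol_form vs x y h = (\<Sum>i<length vs - 1.
     leibniz_det (length vs - 1) (mixed_rows i (gram_entry vs x) (gram_entry vs h i) (gram_entry vs y)))"

text \<open>\<open>gram_entry vs\<close> is linear in the distances, so the row replaced in the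
  telescoping sum is the Gram row of the difference.\<close>

lemma vol_poly_diff: "vol_poly vs x - vol_poly vs y = vol_form vs x y (\<lambda>e. x e - y e)"
proof -
  have "(\<lambda>j. gram_entry vs x i j - gram_entry vs y i j) = gram_entry vs (\<lambda>e. x e - y e) i" for i
    by (auto simp: gram_entry_def field_simps)
  then show ?thesis
    by (simp add: vol_poly_def vol_form_def leibniz_det_diff)
qed

text \<open>Each summand is linear in its replaced row, the only place where \<open>h\<close>
  occurs, and on the pairs that occur \<open>h\<close> is a combination of indicator functions of
  the elements of \<open>E\<close>.\<close>

lemma vol_form_expand:
  assumes "finite E" and h: "\<And>u v. u \<in> set vs \<Longrightarrow> v \<in> set vs \<Longrightarrow> {u, v} \<in> E \<or> h {u, v} = 0"
  shows "vol_form vs x y h = (\<Sum>f\<in>E. h f * vol_form vs x y (\<lambda>e. of_bool (e = f)))"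
proof -
  let ?m = "length vs - 1"
  have expand: "h {u, v} = (\<Sum>f\<in>E. h f * of_bool ({u, v} = f))" if "u \<in> set vs" "v \<in> set vs" for u v
  proof -
    have "(\<Sum>f\<in>E. h f * of_bool ({u, v} = f)) = (\<Sum>f\<in>E. if {u, v} = f then h f else 0)"
      by (intro sum.cong) auto
    then show ?thesis using h[OF that] \<open>finite E\<close> by auto
  qed
  have entry: "gram_entry vs h i j = (\<Sum>f\<in>E. h f * gram_entry vs (\<lambda>e. of_bool (e = f)) i j)"
    if "i < ?m" "j < ?m" for i j
  proof -
    have "vs ! 0 \<in> set vs" "vs ! Suc i \<in> set vs" "vs ! Suc j \<in> set vs"
      using that by (auto intro!: nth_mem)
    then show ?thesis
      unfolding gram_entry_def
      by (simp add: expand sum.distrib sum_subtractf sum_divide_distrib[symmetric] distrib_left right_diff_distrib)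
  qed
  have "leibniz_det ?m (mixed_rows i a (gram_entry vs h i) b) =
      (\<Sum>f\<in>E. h f * leibniz_det ?m (mixed_rows i a (gram_entry vs (\<lambda>e. of_bool (e = f)) i) b))"
    if "i < ?m" for i a b
  proof -
    have "leibniz_det ?m (mixed_rows i a (gram_entry vs h i) b) =
        leibniz_det ?m (mixed_rows i a (\<lambda>j. \<Sum>f\<in>E. h f * gram_entry vs (\<lambda>e. of_bool (e = f)) i j) b)"
      using that by (intro leibniz_det_cong) (auto simp: mixed_rows_def entry)
    then show ?thesis
      unfolding mixed_rows_def using leibniz_det_row_sum[OF that] by simp
  qed
  then have "vol_form vs x y h = (\<Sum>i<?m. \<Sum>f\<in>E. h f * leibniz_det ?m
      (mixed_rows i (gram_entry vs x) (gram_entry vs (\<lambda>e. of_bool (e = f)) i) (gram_entry vs y)))"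
    by (simp add: vol_form_def)
  also have "\<dots> = (\<Sum>f\<in>E. h f * vol_form vs x y (\<lambda>e. of_bool (e = f)))"
    unfolding vol_form_def sum_distrib_left by (rule sum.swap)
  finally show ?thesis .
qed

text \<open>Polarization expresses the inner products of edge vectors at the first vertex by squared
  distances.\<close>

lemma gram_det_eq_vol_poly:
  assumes "vs \<noteq> []"
  shows "gram_det (map (\<lambda>x. x - hd (map p vs)) (tl (map p vs))) = vol_poly vs (sqlen p)"
proof -
  have "gram_det (map (\<lambda>x. x - hd (map p vs)) (tl (map p vs))) = leibniz_det (length vs - 1)
      (\<lambda>i j. (p (vs ! Suc i) - p (vs ! 0)) \<bullet> (p (vs ! Suc j) - p (vs ! 0)))"
    unfolding gram_det_def leibniz_det_def
  proof (intro sum.cong arg_cong2[where f = "(*)"] prod.cong refl)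
    fix \<sigma> i
    assume "\<sigma> \<in> {\<sigma>. \<sigma> permutes {..<length vs - 1}}" "i \<in> {..<length vs - 1}"
    then have "i < length vs - 1" "\<sigma> i < length vs - 1"
      using permutes_in_image[of \<sigma> "{..<length vs - 1}" i] by auto
    then show "map (\<lambda>x. x - hd (map p vs)) (tl (map p vs)) ! i \<bullet>
        map (\<lambda>x. x - hd (map p vs)) (tl (map p vs)) ! \<sigma> i =
        (p (vs ! Suc i) - p (vs ! 0)) \<bullet> (p (vs ! Suc (\<sigma> i)) - p (vs ! 0))"
      using assms by (simp add: nth_tl hd_map hd_conv_nth map_tl[symmetric] del: map_tl)
  qed simp_all
  also have "\<dots> = vol_poly vs (sqlen p)"
    unfolding vol_poly_def
    by (intro leibniz_det_cong)
      (simp add: gram_entry_def inner_diff_left inner_diff_right inner_commute)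
  finally show ?thesis .
qed

text \<open>Both sides carry the same factorial, and the real square root is injective on all
  reals.\<close>

lemma vol_poly_eq_if_edge_vol_eq:
  assumes "finite \<Delta>" "\<Delta> \<noteq> {}" and "edge_vol p \<Delta> = edge_vol q \<Delta>"
  shows "vol_poly (sorted_list_of_set \<Delta>) (sqlen p) = vol_poly (sorted_list_of_set \<Delta>) (sqlen q)"
proof -
  have ne: "sorted_list_of_set \<Delta> \<noteq> []"
    using assms by simp
  show ?thesis
    using assms(3)
    unfolding edge_vol_def simplex_vol_def wedge_norm_def gram_det_eq_vol_poly[OF ne] by simp
qed

text \<open>At squared edge length 2 the Gram matrix is the identity plus the all-ones matrix, and
  \<open>leibniz_det_regular_replace_row\<close> evaluates every summand. In the total, the first
  vertex loses its special role: the derivative is a multiple of the sum of \<open>h\<close> over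
  all pairs.\<close>

lemma vol_form_regular:
  assumes vs: "distinct vs" "vs \<noteq> []"
    and y: "\<And>u v. u \<in> set vs \<Longrightarrow> v \<in> set vs \<Longrightarrow> y {u, v} = (if u = v then 0 else 2)"
    and h: "\<And>u. h {u} = 0"
  shows "vol_form vs y y h = leibniz_det (length vs - 1) (\<lambda>i j. if i = j then 2 else 1) *
    (\<Sum>u\<in>set vs. \<Sum>v\<in>set vs. h {u, v}) / (2 * real (length vs))"
proof -
  let ?m = "length vs - 1"
  define M :: "nat \<Rightarrow> nat \<Rightarrow> real" where "M = (\<lambda>i j. if i = j then 2 else 1)"
  define a where "a i = h {vs ! 0, vs ! Suc i}" for i
  define c where "c i j = h {vs ! Suc i, vs ! Suc j}" for i j
  have m: "real (length vs) = real ?m + 1" using vs by (cases vs) auto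
  have entry: "gram_entry vs y i j = M i j" if "i < ?m" "j < ?m" for i j
    using that vs by (simp add: gram_entry_def y M_def nth_eq_iff_index_eq)
  have Lh: "gram_entry vs h i j = (a i + a j - c i j) / 2" for i j
    by (simp add: gram_entry_def a_def c_def)
  have cii: "c i i = 0" for i by (simp add: c_def h)
  have sum_set: "(\<Sum>t\<in>set (tl vs). F t) = (\<Sum>i<?m. F (vs ! Suc i))" for F :: "nat \<Rightarrow> real"
  proof -
    have "(\<Sum>t\<in>set (tl vs). F t) = (\<Sum>i<length (tl vs). F (tl vs ! i))"
      using sum.reindex_bij_betw[OF bij_betw_nth[OF distinct_tl[OF vs(1)] refl refl], of F] by simp
    then show ?thesis by (simp add: nth_tl)
  qed
  have set_vs: "set vs = insert (vs ! 0) (set (tl vs))" and hd_notin: "vs ! 0 \<notin> set (tl vs)"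
    using vs by (cases vs; simp)+
  have total: "(\<Sum>u\<in>set vs. \<Sum>v\<in>set vs. h {u, v}) = 2 * (\<Sum>i<?m. a i) + (\<Sum>i<?m. \<Sum>j<?m. c i j)"
    unfolding set_vs using hd_notin
    by (simp add: sum.distrib h insert_commute sum_set a_def c_def)
  have "vol_form vs y y h = (\<Sum>i<?m. leibniz_det ?m (M(i := gram_entry vs h i)))"
    unfolding vol_form_def
    by (intro sum.cong refl leibniz_det_cong) (auto simp: mixed_rows_def entry)
  \<comment> \<open>The diagonal entry of the replacing row is \<open>a i\<close>, because
    \<open>c i i = 0\<close>.\<close>
  also have "\<dots> = (\<Sum>i<?m. (a i - (\<Sum>j<?m. (a i + a j - c i j) / 2) / (real ?m + 1)) * leibniz_det ?m M)"
    by (intro sum.cong refl) (simp add: M_def leibniz_det_regular_replace_row Lh cii)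
  also have "\<dots> = ((\<Sum>i<?m. a i) - (\<Sum>i<?m. \<Sum>j<?m. (a i + a j - c i j) / 2) / (real ?m + 1)) * leibniz_det ?m M"
    by (simp only: sum_distrib_right[symmetric] sum_subtractf sum_divide_distrib[symmetric])
  also have "(\<Sum>i<?m. \<Sum>j<?m. (a i + a j - c i j) / 2) =
      real ?m * (\<Sum>i<?m. a i) - (\<Sum>i<?m. \<Sum>j<?m. c i j) / 2"
    by (simp only: sum.distrib sum_subtractf sum_divide_distrib[symmetric] sum_constant card_lessThan
        sum_distrib_left[symmetric]) (simp add: field_simps)
  also have "((\<Sum>i<?m. a i) - (real ?m * (\<Sum>i<?m. a i) - (\<Sum>i<?m. \<Sum>j<?m. c i j) / 2) / (real ?m + 1)) =
      (2 * (\<Sum>i<?m. a i) + (\<Sum>i<?m. \<Sum>j<?m. c i j)) / (2 * (real ?m + 1))"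
    by (simp add: field_simps)
  finally show ?thesis
    unfolding total m M_def by simp
qed

text \<open>The basis vectors have mutual squared distance 2; one further apex on the line spanned
  by their sum completes the simplex.\<close>

lemma regular_simplex_exists:
  assumes "finite S" "card S = DIM('a) + 1"
  obtains r :: "nat \<Rightarrow> 'a::euclidean_space"
  where "\<And>u v. u \<in> S \<Longrightarrow> v \<in> S \<Longrightarrow> u \<noteq> v \<Longrightarrow> (r u - r v) \<bullet> (r u - r v) = 2"
proof -
  let ?d = "real DIM('a)"
  obtain w where w: "w \<in> S" using assms by fastforce
  then have "card (S - {w}) = card (Basis :: 'a set)" using assms by simp
  then obtain b where b: "bij_betw b (S - {w}) (Basis :: 'a set)"
    using assms(1) finite_same_card_bij[OF _ finite_Basis] by blast
  \<comment> \<open>A root of \<open>d * t\<^sup>2 - 2 * t + 1 = 2\<close>, the squared distance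
    from the apex to a basis vector.\<close>
  define t where "t = (1 + sqrt (1 + ?d)) / ?d"
  have t: "?d * t\<^sup>2 - 2 * t = 1"
  proof -
    have "?d \<noteq> 0" by simp
    have "(?d * t - 1)\<^sup>2 = 1 + ?d" by (simp add: t_def)
    then have "?d * (?d * t\<^sup>2 - 2 * t) = ?d * 1"
      by (simp add: power2_eq_square algebra_simps)
    then show ?thesis using \<open>?d \<noteq> 0\<close> by (metis mult_left_cancel)
  qed
  define s :: 'a where "s = t *\<^sub>R \<Sum>Basis"
  define r where "r v = (if v = w then s else b v)" for v
  have bB: "b v \<in> Basis" if "v \<in> S" "v \<noteq> w" for v
    using b that by (auto simp: bij_betw_def)
  have ss: "s \<bullet> s = ?d * t\<^sup>2"
    by (simp add: s_def inner_sum_left inner_sum_right inner_Basis power2_eq_square)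
  have sb: "s \<bullet> x = t" "x \<bullet> s = t" if "x \<in> Basis" for x
    using that by (simp_all add: s_def inner_sum_left inner_sum_right inner_Basis inner_commute)
  have apex: "(s - x) \<bullet> (s - x) = 2" "(x - s) \<bullet> (x - s) = 2" if "x \<in> Basis" for x
    using t that by (simp_all add: inner_diff_left inner_diff_right ss sb)
  have base: "(b u - b v) \<bullet> (b u - b v) = 2" if "u \<in> S" "v \<in> S" "u \<noteq> v" "u \<noteq> w" "v \<noteq> w" for u v
  proof -
    have "b u \<noteq> b v"
      using b that by (auto simp: bij_betw_def inj_on_def)
    then show ?thesis
      using bB that by (simp add: inner_diff_left inner_diff_right inner_Basis)
  qed
  show ?thesis
  proof (rule that)
    fix u v assume "u \<in> S" "v \<in> S" "u \<noteq> v"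
    then show "(r u - r v) \<bullet> (r u - r v) = 2"
      using apex bB base by (auto simp: r_def)
  qed
qed

section \<open>Rigidity at generic configurations\<close>

lemma rat_poly_fun_leibniz_det:
  assumes "\<And>i j. i < m \<Longrightarrow> j < m \<Longrightarrow> rat_poly_fun I (\<lambda>x. a x i j)"
  shows "rat_poly_fun I (\<lambda>x. leibniz_det m (a x))"
  unfolding leibniz_det_def
proof (intro rat_poly_fun_sum rat_poly_fun.mult rat_poly_fun_prod)
  fix \<sigma> i assume "\<sigma> \<in> {\<sigma>. \<sigma> permutes {..<m}}" "i \<in> {..<m}"
  then show "rat_poly_fun I (\<lambda>x. a x i (\<sigma> i))"
    using assms permutes_in_image[of \<sigma> "{..<m}" i] by auto
qed (simp add: rat_poly_fun.const)

lemma tendsto_leibniz_det: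
  assumes "\<And>i j. i < m \<Longrightarrow> j < m \<Longrightarrow> ((\<lambda>x. a x i j) \<longlongrightarrow> b i j) F"
  shows "((\<lambda>x. leibniz_det m (a x)) \<longlongrightarrow> leibniz_det m b) F"
  unfolding leibniz_det_def
proof (intro tendsto_sum tendsto_mult tendsto_prod tendsto_const)
  fix \<sigma> i assume "\<sigma> \<in> {\<sigma>. \<sigma> permutes {..<m}}" "i \<in> {..<m}"
  then show "((\<lambda>x. a x i (\<sigma> i)) \<longlongrightarrow> b i (\<sigma> i)) F"
    using assms permutes_in_image[of \<sigma> "{..<m}" i] by auto
qed

lemma rat_poly_fun_gram_entry:
  assumes "\<And>u v. u \<in> set vs \<Longrightarrow> v \<in> set vs \<Longrightarrow> rat_poly_fun I (\<lambda>t. X t {u, v})"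
    and "i < length vs - 1" "j < length vs - 1"
  shows "rat_poly_fun I (\<lambda>t. gram_entry vs (X t) i j)"
  unfolding gram_entry_def
  by (intro rat_poly_fun_divide_numeral rat_poly_fun_diff rat_poly_fun.add assms(1) nth_mem)
    (use assms(2,3) in auto)

lemma tendsto_gram_entry:
  assumes "\<And>u v. u \<in> set vs \<Longrightarrow> v \<in> set vs \<Longrightarrow> ((\<lambda>t. X t {u, v}) \<longlongrightarrow> x {u, v}) F"
    and "i < length vs - 1" "j < length vs - 1"
  shows "((\<lambda>t. gram_entry vs (X t) i j) \<longlongrightarrow> gram_entry vs x i j) F"
  unfolding gram_entry_def
  by (intro tendsto_divide tendsto_diff tendsto_add tendsto_const assms(1) nth_mem)
    (use assms(2,3) in auto)

lemma rat_poly_fun_vol_form: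
  assumes X: "\<And>u v. u \<in> set vs \<Longrightarrow> v \<in> set vs \<Longrightarrow> rat_poly_fun I (\<lambda>t. X t {u, v})"
    and Y: "\<And>u v. u \<in> set vs \<Longrightarrow> v \<in> set vs \<Longrightarrow> rat_poly_fun I (\<lambda>t. Y t {u, v})"
    and h: "\<And>e. h e \<in> \<rat>"
  shows "rat_poly_fun I (\<lambda>t. vol_form vs (X t) (Y t) h)"
  unfolding vol_form_def
proof (intro rat_poly_fun_sum rat_poly_fun_leibniz_det)
  fix l i j assume "i < length vs - 1" "j < length vs - 1"
  moreover have "rat_poly_fun I (\<lambda>t. gram_entry vs h l j)"
    by (intro rat_poly_fun.const) (simp add: gram_entry_def h)
  ultimately show "rat_poly_fun I (\<lambda>t. mixed_rows l (gram_entry vs (X t)) (gram_entry vs h l) (gram_entry vs (Y t)) i j)"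
    unfolding mixed_rows_def
    by (cases "i = l"; cases "i < l") (simp_all add: rat_poly_fun_gram_entry X Y)
qed

lemma tendsto_vol_form:
  assumes X: "\<And>u v. u \<in> set vs \<Longrightarrow> v \<in> set vs \<Longrightarrow> ((\<lambda>t. X t {u, v}) \<longlongrightarrow> x {u, v}) F"
  shows "((\<lambda>t. vol_form vs (X t) y h) \<longlongrightarrow> vol_form vs x y h) F"
  unfolding vol_form_def
proof (intro tendsto_sum tendsto_leibniz_det)
  fix l i j assume "i < length vs - 1" "j < length vs - 1"
  then show "((\<lambda>t. mixed_rows l (gram_entry vs (X t)) (gram_entry vs h l) (gram_entry vs y) i j)
      \<longlongrightarrow> mixed_rows l (gram_entry vs x) (gram_entry vs h l) (gram_entry vs y) i j) F"
    unfolding mixed_rows_def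
    by (cases "i = l"; cases "i < l") (simp_all add: tendsto_gram_entry X)
qed

section \<open>The matrix of volume coefficients and its Gram determinant\<close>

lemma set_sorted_list_of_set_subset: "set (sorted_list_of_set A) \<subseteq> A"
  by (cases "finite A") auto

text \<open>The entry of \<open>G(x, y)\<close> in row \<Delta> and column \<open>f\<close>, read
  off by applying the linear form to an indicator function.\<close>

definition vol_coeff :: "(nat set \<Rightarrow> real) \<Rightarrow> (nat set \<Rightarrow> real) \<Rightarrow> nat set \<Rightarrow> nat set \<Rightarrow> real" where
  "vol_coeff x y \<Delta> f = vol_form (sorted_list_of_set \<Delta>) x y (\<lambda>e. of_bool (e = f))"

definition subsets_of_card :: "nat set \<Rightarrow> nat \<Rightarrow> nat set set" where
  "subsets_of_card S k = {\<Delta>. \<Delta> \<subseteq> S \<and> card \<Delta> = k}"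

lemma finite_subsets_of_card [simp]: "finite S \<Longrightarrow> finite (subsets_of_card S k)"
  by (simp add: subsets_of_card_def)

lemma vol_form_eq_sum_vol_coeff:
  assumes S: "finite S" "\<Delta> \<subseteq> S" and h: "\<And>u. h {u} = 0"
  shows "vol_form (sorted_list_of_set \<Delta>) x y h = (\<Sum>f\<in>subsets_of_card S 2. vol_coeff x y \<Delta> f * h f)"
proof -
  have "vol_form (sorted_list_of_set \<Delta>) x y h =
      (\<Sum>f\<in>subsets_of_card S 2. h f * vol_form (sorted_list_of_set \<Delta>) x y (\<lambda>e. of_bool (e = f)))"
  proof (rule vol_form_expand)
    fix u v assume "u \<in> set (sorted_list_of_set \<Delta>)" "v \<in> set (sorted_list_of_set \<Delta>)"
    moreover have "finite \<Delta>" using S finite_subset by blast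
    ultimately have "u \<in> S" "v \<in> S" using S by auto
    then show "{u, v} \<in> subsets_of_card S 2 \<or> h {u, v} = 0"
      by (cases "u = v") (auto simp: h subsets_of_card_def)
  qed (use S in simp)
  then show ?thesis by (simp add: vol_coeff_def mult.commute)
qed

text \<open>This is \<open>det (G(y, y)\<^sup>T G(x, y))\<close>, a square determinant for a matrix
  \<open>G\<close> that may be rectangular. If it is nonzero, \<open>G(x, y)\<close> is
  injective.\<close>

definition rigidity_gramian :: "nat set list \<Rightarrow> nat set set \<Rightarrow> (nat set \<Rightarrow> real) \<Rightarrow> (nat set \<Rightarrow> real) \<Rightarrow> real" where
  "rigidity_gramian es D x y = gramian es D (vol_coeff y y) (vol_coeff x y)"

text \<open>A kernel vector of \<open>G(y, y)\<close> would have vanishing pair sums over all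
  \<open>k\<close>-subsets of \<open>S\<close> by \<open>vol_form_regular\<close>, hence be zero by
  \<open>pair_sums_injective\<close>.\<close>

lemma rigidity_gramian_regular_nonzero:
  assumes es: "distinct es" "set es = subsets_of_card S 2"
    and S: "finite S" "k + 2 \<le> card S" and k: "2 \<le> k"
    and y: "\<And>u v. u \<in> S \<Longrightarrow> v \<in> S \<Longrightarrow> y {u, v} = (if u = v then 0 else 2)"
  shows "rigidity_gramian es (subsets_of_card S k) y y \<noteq> 0"
proof
  assume "rigidity_gramian es (subsets_of_card S k) y y = 0"
  then obtain h where h: "\<exists>e\<in>subsets_of_card S 2. h e \<noteq> 0"
    "\<And>\<Delta>. \<Delta> \<in> subsets_of_card S k \<Longrightarrow> (\<Sum>f\<in>subsets_of_card S 2. vol_coeff y y \<Delta> f * h f) = 0"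
    unfolding rigidity_gramian_def
    using gramian_self_eq_0D[OF es(1), of "subsets_of_card S k" "vol_coeff y y"] S es(2) by auto
  \<comment> \<open>Cutting \<open>h\<close> off outside pairs gives the value 0 on singletons and
    leaves the kernel equations unchanged.\<close>
  define h' where "h' e = (if card e = 2 then h e else 0)" for e
  have h'0: "h' {u} = 0" for u by (simp add: h'_def)
  have sums: "(\<Sum>u\<in>\<Delta>. \<Sum>v\<in>\<Delta>. h' {u, v}) = 0" if \<Delta>: "\<Delta> \<subseteq> S" "card \<Delta> = k" for \<Delta>
  proof -
    let ?vs = "sorted_list_of_set \<Delta>"
    have fin: "finite \<Delta>" using \<Delta> S finite_subset by blast
    have "\<Delta> \<noteq> {}" using \<Delta> k by auto
    have "vol_form ?vs y y h' = (\<Sum>f\<in>subsets_of_card S 2. vol_coeff y y \<Delta> f * h' f)"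
      by (rule vol_form_eq_sum_vol_coeff[where h = h', OF S(1) \<Delta>(1) h'0])
    also have "\<dots> = (\<Sum>f\<in>subsets_of_card S 2. vol_coeff y y \<Delta> f * h f)"
      by (intro sum.cong) (auto simp: h'_def subsets_of_card_def)
    also have "\<dots> = 0"
      using h(2) \<Delta> by (simp add: subsets_of_card_def)
    finally have "vol_form ?vs y y h' = 0" .
    moreover have "vol_form ?vs y y h' = leibniz_det (length ?vs - 1) (\<lambda>i j. if i = j then 2 else 1) *
        (\<Sum>u\<in>set ?vs. \<Sum>v\<in>set ?vs. h' {u, v}) / (2 * real (length ?vs))"
    proof (rule vol_form_regular)
      show "y {u, v} = (if u = v then 0 else 2)" if "u \<in> set ?vs" "v \<in> set ?vs" for u v
        using that fin \<Delta> by (intro y) auto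
    qed (use fin \<open>\<Delta> \<noteq> {}\<close> h'0 in auto)
    ultimately show ?thesis
      using fin \<open>\<Delta> \<noteq> {}\<close> leibniz_det_regular_nonzero[of "length ?vs - 1"] by simp
  qed
  obtain e where e: "e \<subseteq> S" "card e = 2" "h e \<noteq> 0"
    using h(1) by (auto simp: subsets_of_card_def)
  then obtain u v where uv: "e = {u, v}" "u \<noteq> v"
    by (meson card_2_iff)
  have "h' {u, v} = 0"
    using e uv by (intro pair_sums_injective[where h = h', OF S k h'0 sums]) auto
  with e uv show False by (simp add: h'_def)
qed

text \<open>Equal volumes put the difference of the squared distances into the kernel of
  \<open>G(x, y)\<close>, with \<open>x\<close> and \<open>y\<close> the squared distances of
  \<open>q\<close> and \<open>p\<close>.\<close>

lemma sqlen_eq_if_rigidity_gramian_nonzero: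
  assumes es: "distinct es" "set es = subsets_of_card S 2" and S: "finite S" and k: "2 \<le> k"
    and nz: "rigidity_gramian es (subsets_of_card S k) (sqlen q) (sqlen p) \<noteq> 0"
    and vol: "\<And>\<Delta>. \<Delta> \<subseteq> S \<Longrightarrow> card \<Delta> = k \<Longrightarrow> edge_vol p \<Delta> = edge_vol q \<Delta>"
    and uv: "u \<in> S" "v \<in> S"
  shows "sqlen q {u, v} = sqlen p {u, v}"
proof (cases "u = v")
  case False
  define h where "h e = sqlen q e - sqlen p e" for e
  have "(\<Sum>f\<in>set es. vol_coeff (sqlen q) (sqlen p) \<Delta> f * h f) = 0" if "\<Delta> \<in> subsets_of_card S k" for \<Delta>
  proof -
    from that have \<Delta>: "\<Delta> \<subseteq> S" "card \<Delta> = k" by (auto simp: subsets_of_card_def)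
    then have "finite \<Delta>" "\<Delta> \<noteq> {}" using S k finite_subset by auto
    then have "vol_poly (sorted_list_of_set \<Delta>) (sqlen q) - vol_poly (sorted_list_of_set \<Delta>) (sqlen p) = 0"
      using vol_poly_eq_if_edge_vol_eq[OF _ _ vol[OF \<Delta>]] by simp
    then have "vol_form (sorted_list_of_set \<Delta>) (sqlen q) (sqlen p) h = 0"
      unfolding vol_poly_diff h_def .
    then show ?thesis
      using vol_form_eq_sum_vol_coeff[OF S \<Delta>(1), of h] by (simp add: es h_def)
  qed
  then have "\<forall>e\<in>set es. (\<Sum>\<Delta>\<in>subsets_of_card S k. vol_coeff (sqlen p) (sqlen p) \<Delta> e *
      (\<Sum>f\<in>set es. vol_coeff (sqlen q) (sqlen p) \<Delta> f * h f)) = 0"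
    by simp
  then have "h e = 0" if "e \<in> set es" for e
    using nz that unfolding rigidity_gramian_def gramian_eq_0_iff[OF es(1)] by blast
  moreover have "{u, v} \<in> set es"
    using False uv es by (simp add: subsets_of_card_def)
  ultimately have "h {u, v} = 0" .
  then show ?thesis unfolding h_def by linarith
qed simp

text \<open>As a rational polynomial in the coordinates, the determinant would vanish identically if
  it vanished at \<open>p\<close>, contradicting its value at a regular simplex.\<close>

lemma rigidity_gramian_generic_nonzero:
  fixes p :: "nat \<Rightarrow> 'a::euclidean_space"
  assumes es: "distinct es" "set es = subsets_of_card S 2"
    and S: "S \<subseteq> {0..<n}" "card S = DIM('a) + 1" and k: "2 \<le> k" "k + 1 \<le> DIM('a)"
    and gen: "generic n p"
  shows "rigidity_gramian es (subsets_of_card S k) (sqlen p) (sqlen p) \<noteq> 0"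
proof
  let ?I = "{0..<n} \<times> (Basis :: 'a set)"
  \<comment> \<open>\<open>pt\<close> rebuilds a configuration from its coordinates, inverting the
    coordinate map in \<open>generic\<close>.\<close>
  define pt :: "(nat \<times> 'a \<Rightarrow> real) \<Rightarrow> nat \<Rightarrow> 'a" where "pt x v = (\<Sum>b\<in>Basis. x (v, b) *\<^sub>R b)" for x v
  define P where "P x = rigidity_gramian es (subsets_of_card S k) (sqlen (pt x)) (sqlen (pt x))" for x
  have fS: "finite S" using S finite_subset by blast
  have pt_coords: "pt (\<lambda>(v, b). r v \<bullet> b) = r" for r
    by (simp add: pt_def euclidean_representation fun_eq_iff)
  have sq: "rat_poly_fun ?I (\<lambda>x. sqlen (pt x) {u, v})" if "u \<in> S" "v \<in> S" for u v
  proof -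
    have "sqlen (pt x) {u, v} = (\<Sum>b\<in>Basis. (x (u, b) - x (v, b)) * (x (u, b) - x (v, b)))" for x
    proof -
      have "pt x u \<bullet> b = x (u, b)" "pt x v \<bullet> b = x (v, b)" if "b \<in> Basis" for b
        using that by (simp_all add: pt_def inner_sum_left_Basis)
      then show ?thesis
        unfolding sqlen_pair by (subst euclidean_inner) (simp add: inner_diff_left)
    qed
    then show ?thesis
      using that S(1)
      by (auto intro!: rat_poly_fun_sum rat_poly_fun.mult rat_poly_fun_diff rat_poly_fun.var)
  qed
  have "rat_poly_fun ?I P"
    unfolding P_def rigidity_gramian_def gramian_def vol_coeff_def
    by (intro rat_poly_fun_leibniz_det rat_poly_fun_sum rat_poly_fun.mult rat_poly_fun_vol_form sq)
      (auto simp: subsets_of_card_def dest!: subsetD[OF set_sorted_list_of_set_subset])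
  moreover assume "rigidity_gramian es (subsets_of_card S k) (sqlen p) (sqlen p) = 0"
  then have "P (\<lambda>(v, b). p v \<bullet> b) = 0"
    by (simp add: P_def pt_coords)
  ultimately have P0: "P x = 0" for x
    using rat_poly_fun_eq_0_if_alg_indep[of ?I P] gen unfolding generic_def by simp
  obtain r :: "nat \<Rightarrow> 'a" where r: "\<And>u v. u \<in> S \<Longrightarrow> v \<in> S \<Longrightarrow> u \<noteq> v \<Longrightarrow> (r u - r v) \<bullet> (r u - r v) = 2"
    using regular_simplex_exists[OF fS S(2)] by blast
  have "rigidity_gramian es (subsets_of_card S k) (sqlen r) (sqlen r) \<noteq> 0"
    by (rule rigidity_gramian_regular_nonzero[OF es fS _ k(1)]) (use r k S in auto)
  then show False
    using P0[of "\<lambda>(v, b). r v \<bullet> b"] by (simp add: P_def pt_coords)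
qed

lemma tendsto_rigidity_gramian:
  assumes X: "\<And>u v. u \<in> S \<Longrightarrow> v \<in> S \<Longrightarrow> ((\<lambda>t. X t {u, v}) \<longlongrightarrow> x {u, v}) F"
  shows "((\<lambda>t. rigidity_gramian es (subsets_of_card S k) (X t) y) \<longlongrightarrow> rigidity_gramian es (subsets_of_card S k) x y) F"
  unfolding rigidity_gramian_def gramian_def vol_coeff_def
  by (intro tendsto_leibniz_det tendsto_sum tendsto_mult tendsto_const tendsto_vol_form X)
    (auto simp: subsets_of_card_def dest!: subsetD[OF set_sorted_list_of_set_subset])

section \<open>Volume rigidity, by convergent sequences of realisations\<close>

theorem theorem2p3:
  fixes p :: "nat \<Rightarrow> 'a::euclidean_space" and n d k :: nat
  assumes "DIM('a) = d"
    and "2 \<le> k" and "k \<le> d - 1" and "d - 1 \<le> n - 2"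
    and "generic n p"
  shows "volume_rigid {0..<n} (complete_hyper n k) p"
proof (rule ccontr)
  assume "\<not> ?thesis"
  \<comment> \<open>The radii \<open>1 / real (Suc m)\<close> yield volume equivalent, non-congruent
    realisations converging to \<open>p\<close>; limits then replace the choice of a common radius
    for all pairs.\<close>
  then have "\<exists>q. (\<forall>v\<in>{0..<n}. dist (q v) (p v) < 1 / real (Suc m)) \<and> volume_equivalent (complete_hyper n k) p q \<and>
      \<not> congruent {0..<n} p q" for m
    unfolding volume_rigid_def by (auto dest!: spec[of _ "1 / real (Suc m)"])
  then obtain q where q: "\<And>m v. v < n \<Longrightarrow> dist (q m v) (p v) < 1 / real (Suc m)"
    and vol: "\<And>m. volume_equivalent (complete_hyper n k) p (q m)"
    and not_cong: "\<And>m. \<not> congruent {0..<n} p (q m)"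
    by (metis atLeastLessThan_iff zero_le)
  have lim: "(\<lambda>m. q m v) \<longlonglongrightarrow> p v" if "v < n" for v
  proof (rule metric_tendsto_imp_tendsto[of "\<lambda>m. 1 / real (Suc m)" 0])
    show "(\<lambda>m. 1 / real (Suc m)) \<longlonglongrightarrow> 0"
      by (rule LIMSEQ_Suc[OF lim_1_over_n])
    show "\<forall>\<^sub>F m in sequentially. dist (q m v) (p v) \<le> dist (1 / real (Suc m)) 0"
      using q[OF that] by (intro always_eventually allI) (simp add: less_imp_le)
  qed
  have "\<forall>\<^sub>F m in sequentially. sqlen (q m) {u, v} = sqlen p {u, v}" if uv: "u < n" "v < n" for u v
  proof -
    \<comment> \<open>From \<open>2 \<le> k \<le> d - 1\<close> the bound on \<open>d - 1\<close> is
      at least 2, so no subtraction is truncated and \<open>d + 1 \<le> n\<close>.\<close>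
    have "d + 1 \<le> card {0..<n}" "card {u, v} \<le> d + 1"
      using assms by (auto simp: card_insert_if)
    then obtain S where S: "{u, v} \<subseteq> S" "S \<subseteq> {0..<n}" "card S = d + 1"
      using exists_subset_between[of "{u, v}" "d + 1" "{0..<n}"] uv by auto
    have fS: "finite S" using S finite_subset by blast
    obtain es where es: "distinct es" "set es = subsets_of_card S 2"
      using finite_distinct_list[OF finite_subsets_of_card[OF fS]] by blast
    let ?G = "\<lambda>x. rigidity_gramian es (subsets_of_card S k) x (sqlen p)"
    have "?G (sqlen p) \<noteq> 0"
      by (rule rigidity_gramian_generic_nonzero[OF es S(2)]) (use assms S in auto)
    moreover have "(\<lambda>m. ?G (sqlen (q m))) \<longlonglongrightarrow> ?G (sqlen p)"
      using S(2) by (intro tendsto_rigidity_gramian) (auto intro!: tendsto_intros lim)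
    ultimately have "\<forall>\<^sub>F m in sequentially. ?G (sqlen (q m)) \<noteq> 0"
      using tendsto_imp_eventually_ne by blast
    then show ?thesis
    proof eventually_elim
      case (elim m)
      show ?case
      proof (rule sqlen_eq_if_rigidity_gramian_nonzero[OF es fS assms(2) elim])
        show "edge_vol p \<Delta> = edge_vol (q m) \<Delta>" if "\<Delta> \<subseteq> S" "card \<Delta> = k" for \<Delta>
          using vol[of m] that S(2) by (auto simp: volume_equivalent_def complete_hyper_def)
      qed (use S in auto)
    qed
  qed
  \<comment> \<open>There are only finitely many pairs, so a single \<open>m\<close> serves all of
    them.\<close>
  then have "\<forall>\<^sub>F m in sequentially. \<forall>u\<in>{..<n}. \<forall>v\<in>{..<n}. sqlen (q m) {u, v} = sqlen p {u, v}"
    by (intro eventually_ball_finite ballI) auto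
  then obtain m where m: "\<And>u v. u < n \<Longrightarrow> v < n \<Longrightarrow> sqlen (q m) {u, v} = sqlen p {u, v}"
    by (auto simp: eventually_sequentially)
  have "congruent {0..<n} p (q m)"
    by (rule congruent_if_dist_eq) (use m in \<open>auto simp: dist_norm norm_eq_sqrt_inner\<close>)
  with not_cong show False by blast
qed

end
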